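(* Assume $Z$ is a true $\mathbb Q$-martingale on $[0,T]$, let $q_t=E_{\mathbb Q}[Z_tX_t|\mathcal Y_t]$ and let $v_t$ be the smoother vector (with $v_T=\mathbf 1$ and $E_{\mathbb Q}[Z_TX_t|\mathcal Y_T]=\mathrm{diag}(v_t)q_t$). Define the diagonal matrix-valued process $$\Gamma_t=\exp\Big(-\int_{]0,t]}(\Lambda_s-I)\,ds\Big)\prod_{s\in]0,t]}\Lambda_s^{\Delta Y_s}.$$ Then $\bar q_t:=\Gamma_t^{-1}q_t$ and $\bar v_t:=\Gamma_tv_t$ satisfy, for $0\le t\le T$, $$\bar q_t=\bar q_0+\int_{]0,t]}\Gamma_s^{-1}A_s\Gamma_s\,\bar q_s\,ds,$$ $$\bar v_t=\bar v_0-\int_{]0,t]}\Gamma_sA_s^\top\Gamma_s^{-1}\,\bar v_s\,ds=\Gamma_T\mathbf 1+\int_{]t,T]}\Gamma_sA_s^\top\Gamma_s^{-1}\,\bar v_s\,ds,$$ and $\langle q_t,v_t\rangle=\langle\bar q_t,\bar v_t\rangle$.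
   Context: Let $\mathcal X=\{e_1,\dots,e_N\}$ be the standard basis of $\mathbb R^N$ and $\mathbf 1=(1,\dots,1)^\top$. $X$ is a continuous-time Markov chain with values in $\mathcal X$ and deterministic rate matrix $A_t$ ($[A_t]_{ij}$, $i\ne j$, is the rate of jumping from $e_j$ to $e_i$). $Y$ is a counting process (right-continuous, integer-valued, nondecreasing, $Y_0=0$, jumps of size $1$), $\mathbb D$ its path space, $\mathcal Y_t=\sigma(Y_s;s\le t)$, $\mathcal F_t=\sigma(Y_s,X_s;s\le t)$. The intensity function $\lambda:\mathcal X\times[0,\infty[\times\mathbb D\to]0,\infty[$ is measurable with respect to (all subsets of $\mathcal X$) $\times$ (the predictable $\sigma$-algebra of $\{\mathcal Y_t\}$), with $s\mapsto\lambda(X_{s-},s,Y_{(\cdot)})$ left-continuous; $\lambda_u=\lambda(X_{u-},u,Y_{(\cdot)})$, and $\Lambda_u$ is the diagonal matrix with $(\Lambda_u)_{ii}=\lambda(e_i,u,Y_{(\cdot)})$. $\mathbb Q$ is a measure under which $Y$ is a rate-$1$ Poisson process independent of $X$ and $X$ is Markov with rate matrix $A_t$; $Z_t=\exp(-\int_{]0,t]}(\lambda_u-1)du)\prod_{u\in]0,t]}\lambda_u^{\Delta Y_u}$. The filter satisfies $q_t=q_0+\int_{]0,t]}(\Lambda_u-I)q_{u-}(dY_u-du)+\int_{]0,t]}A_uq_u\,du$ and the smoother vector satisfies $dv_t=-(A_t^\top-\Lambda_t+I)v_{t-}dt+(\Lambda_t^{-1}-I)v_{t-}dY_t$, $v_T=\mathbf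 1$. *)

theory Defs
  imports "HOL-Analysis.Analysis"
begin

text \<open>Pathwise setting. The state space {e_1,...,e_N} is indexed by a finite type 'n;
  vectors in R^N are real^'n and N x N matrices are real^'n^'n.\<close>

definition diagm :: "real^'n \<Rightarrow> real^'n^'n" where
  "diagm d = (\<chi> i j. if i = j then d $ i else 0)"

definition left_lim :: "(real \<Rightarrow> 'a::t2_space) \<Rightarrow> real \<Rightarrow> 'a" where
  "left_lim f t = Lim (at_left t) f"

definition dY :: "(real \<Rightarrow> nat) \<Rightarrow> real \<Rightarrow> real" where
  "dY y u = real (y u) - left_lim (\<lambda>s. real (y s)) u"

definition jump_times :: "(real \<Rightarrow> nat) \<Rightarrow> real \<Rightarrow> real \<Rightarrow> real set" where
  "jump_times y a b = {u \<in> {a<..b}. dY y u \<noteq> 0}"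

definition counting_path :: "(real \<Rightarrow> nat) \<Rightarrow> bool" where
  "counting_path y \<longleftrightarrow> y 0 = 0 \<and> mono_on {0..} y
     \<and> (\<forall>t\<ge>0. continuous (at_right t) (\<lambda>s. real (y s)))
     \<and> (\<forall>t>0. dY y t \<in> {0, 1})"

definition Lam :: "('n \<Rightarrow> real \<Rightarrow> real) \<Rightarrow> real \<Rightarrow> real^'n^'n" where
  "Lam lam u = diagm (\<chi> i. lam i u)"

text \<open>Gamma_t = exp(-int_{]0,t]} (Lambda_s - I) ds) prod_{s in ]0,t]} Lambda_s^{Delta Y_s}
  (all matrices diagonal, so the matrix exponential and the product are taken entrywise).\<close>
definition Gamma :: "('n \<Rightarrow> real \<Rightarrow> real) \<Rightarrow> (real \<Rightarrow> nat) \<Rightarrow> real \<Rightarrow> real^'n^'n" where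
  "Gamma lam y t = diagm (\<chi> i.
      exp (- set_lebesgue_integral lborel {0<..t} (\<lambda>s. lam i s - 1))
      * (\<Prod>u\<in>jump_times y 0 t. lam i u powr dY y u))"

end

theory Submission
  imports Defs
begin

text \<open>
  Since $\<Gamma>$ is diagonal, the claim splits into scalar equations
  $x_t = x_0 + \<Sum>_{u \<le> t} (m_u - 1) x_{u-} - \<integral>_0^t h x + \<integral>_0^t a$, with $m = \<lambda>_i$,
  $h = \<lambda>_i - 1$, $a = (A q)_i$ for the filter and $m = 1/\<lambda>_i$, $h = 1 - \<lambda>_i$,
  $a = -(A^T v)_i$ for the smoother. The integrating factor $R_t = \exp(\<integral>_0^t h) / \<Prod>_{u \<le> t} m_u$
  turns this into $R_t x_t = x_0 + \<integral>_0^t R a$: the jumps of $R$ and $x$ cancel, and between jumps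
  the product rule holds. Since $h$ and $a$ are only integrable, pointwise derivatives are not
  available; instead the difference of the two sides has increments that are locally
  $o(K_t - K_s)$ for the monotone function $K_t = \<integral>_0^t (|h| + |a|)$ plus jump counts, and a
  bisection argument shows that it is constant.
\<close>

section \<open>From local increment bounds to constancy\<close>

text \<open>The local bounds add up over adjacent intervals, so bisection gives the same bound on
  the whole interval for every \<open>e > 0\<close>, and \<open>e\<close> can be made arbitrarily
  small. Only intervals containing \<open>x\<close> are tested, so no derivative of \<open>W\<close>
  occurs and \<open>K\<close> may jump.\<close>

lemma eq_if_increments_locally_small:
  fixes W K :: "real \<Rightarrow> real"
  assumes "a \<le> b"
    and loc: "\<And>e x. e > 0 \<Longrightarrow> x \<in> {a..b} \<Longrightarrow> \<exists>d>0. \<forall>s t. a \<le> s \<and> s \<le> x \<and> x \<le> t \<and> t \<le> b \<and> t - s < d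
                \<longrightarrow> \<bar>W t - W s\<bar> \<le> e * (K t - K s)"
  shows "W b = W a"
proof -
  have *: "\<bar>W b - W a\<bar> \<le> e * (K b - K a)" if "e > 0" for e
  proof -
    \<comment> \<open>The guard \<open>a \<le> s \<and> t \<le> b\<close> is there because bisection
      also asks for \<open>P\<close> on small intervals that stick out of \<open>a..b\<close>, where
      \<open>loc\<close> gives no information.\<close>
    define P where "P s t \<longleftrightarrow> (a \<le> s \<and> t \<le> b \<longrightarrow> \<bar>W t - W s\<bar> \<le> e * (K t - K s))" for s t
    have "P a b"
      using \<open>a \<le> b\<close>
    proof (induct rule: Bolzano)
      case (trans s x t)
      show ?case
        unfolding P_def
      proof
        assume "a \<le> s \<and> t \<le> b"
        with trans have "\<bar>W x - W s\<bar> \<le> e * (K x - K s)" "\<bar>W t - W x\<bar> \<le> e * (K t - K x)"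
          by (auto simp: P_def)
        then show "\<bar>W t - W s\<bar> \<le> e * (K t - K s)"
          by (simp add: algebra_simps)
      qed
    next
      case (local x)
      then show ?case
        using loc[of e x] \<open>e > 0\<close> unfolding P_def atLeastAtMost_iff by meson
    qed
    then show ?thesis by (simp add: P_def)
  qed
  have "\<bar>W b - W a\<bar> \<le> 0"
  proof (rule field_le_epsilon)
    fix e :: real assume "e > 0"
    show "\<bar>W b - W a\<bar> \<le> 0 + e"
    proof (cases "K b - K a \<le> 0")
      case True
      then have "1 * (K b - K a) \<le> 0" by simp
      then show ?thesis using *[of 1] \<open>e > 0\<close> by linarith
    next
      case False
      then show ?thesis using *[of "e / (K b - K a)"] \<open>e > 0\<close> by simp
    qed
  qed
  then show ?thesis by simp
qed

section \<open>Left limits and left discontinuities\<close>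

text \<open>Each such \<open>t\<close> is labelled by a side, a rational \<open>p\<close> strictly
  between the left limit and \<open>f t\<close>, and a window of length \<open>1 / Suc n\<close> to
  the left of \<open>t\<close> on which \<open>f\<close> stays beyond \<open>p\<close>. There are
  countably many labels, and points sharing a label keep a fixed distance from each other.\<close>

lemma countable_left_discontinuities:
  fixes f :: "real \<Rightarrow> real"
  shows "countable {t. \<exists>l. (f \<longlongrightarrow> l) (at_left t) \<and> l \<noteq> f t}" (is "countable ?D")
proof -
  define L where "L p n = {t. f t > real_of_rat p \<and> (\<forall>s. t - 1 / real (Suc n) < s \<and> s < t \<longrightarrow> f s < real_of_rat p)}" for p :: rat and n
  define U where "U p n = {t. f t < real_of_rat p \<and> (\<forall>s. t - 1 / real (Suc n) < s \<and> s < t \<longrightarrow> f s > real_of_rat p)}" for p :: rat and n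
  have sep: "countable D" if "\<And>s t. s \<in> D \<Longrightarrow> t \<in> D \<Longrightarrow> s < t \<Longrightarrow> t - s \<ge> 1 / real (Suc n)" for D :: "real set" and n
  proof -
    \<comment> \<open>Points at distance at least \<open>1 / Suc n\<close> have different integer
      parts after scaling by \<open>Suc n\<close>, so \<open>D\<close> injects into the
      integers.\<close>
    have "inj_on (\<lambda>t. \<lfloor>t * real (Suc n)\<rfloor>) D"
    proof (rule linorder_inj_onI)
      fix s t assume "s < t" "s \<in> D" "t \<in> D"
      then have "1 \<le> (t - s) * real (Suc n)"
        using that[of s t] by (simp add: field_simps)
      then show "\<lfloor>s * real (Suc n)\<rfloor> \<noteq> \<lfloor>t * real (Suc n)\<rfloor>"
        by (simp only: left_diff_distrib) linarith
    qed auto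
    then show ?thesis by (rule countableI')
  qed
  \<comment> \<open>If \<open>s < t\<close> in \<open>L p n\<close> were closer than
    \<open>1 / Suc n\<close>, membership of \<open>s\<close> would give \<open>f s > p\<close>,
    while the window of \<open>t\<close> gives \<open>f s < p\<close>; \<open>U\<close> is
    symmetric.\<close>
  have "countable (L p n)" "countable (U p n)" for p n
    by (rule sep[of _ n]; rule ccontr; force simp: L_def U_def)+
  moreover have "?D \<subseteq> (\<Union>p. \<Union>n. L p n \<union> U p n)"
  proof safe
    fix t l assume l: "(f \<longlongrightarrow> l) (at_left t)" "l \<noteq> f t"
    have near: "\<exists>n. \<forall>s. t - 1 / real (Suc n) < s \<and> s < t \<longrightarrow> P s" if ev: "eventually P (at_left t)" for P
    proof -
      obtain b where b: "b < t" "\<And>s. b < s \<Longrightarrow> s < t \<Longrightarrow> P s"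
        using ev eventually_at_left[of "t - 1" t P] by auto
      then obtain n where "1 / real (Suc n) < t - b"
        using reals_Archimedean[of "t - b"] by (auto simp: inverse_eq_divide)
      then show ?thesis using b by (intro exI[of _ n]) auto
    qed
    show "t \<in> (\<Union>p. \<Union>n. L p n \<union> U p n)"
    proof (cases "l < f t")
      case True
      then obtain p where p: "l < of_rat p" "of_rat p < f t" using of_rat_dense by blast
      obtain n where "\<forall>s. t - 1 / real (Suc n) < s \<and> s < t \<longrightarrow> f s < of_rat p"
        using near order_tendstoD(2)[OF l(1) p(1)] by blast
      then have "t \<in> L p n" using p by (simp add: L_def)
      then show ?thesis by blast
    next
      case False
      then have "f t < l" using l(2) by simp
      then obtain p where p: "f t < of_rat p" "of_rat p < l" using of_rat_dense by blast
      obtain n where "\<forall>s. t - 1 / real (Suc n) < s \<and> s < t \<longrightarrow> f s > of_rat p"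
        using near order_tendstoD(1)[OF l(1) p(2)] by blast
      then have "t \<in> U p n" using p by (simp add: U_def)
      then show ?thesis by blast
    qed
  qed
  ultimately show ?thesis
    by (elim countable_subset) (intro countable_UN countable_Un countableI_type)
qed

lemma left_lim_eq:
  fixes f :: "real \<Rightarrow> 'a::t2_space"
  assumes "(f \<longlongrightarrow> l) (at_left t)"
  shows "left_lim f t = l"
  unfolding left_lim_def by (rule tendsto_Lim[OF _ assms]) simp

section \<open>Jump structure of counting paths\<close>

text \<open>On \<open>{0..<u}\<close> the path takes finitely many values, being bounded by
  \<open>y u\<close>. Their maximum is attained at some \<open>s\<close>, and monotonicity freezes
  the path from \<open>s\<close> until \<open>u\<close>.\<close>

lemma counting_path_left_constant:
  assumes "counting_path y" "0 < u"
  obtains s where "0 \<le> s" "s < u" "\<And>r. s \<le> r \<Longrightarrow> r < u \<Longrightarrow> y r = y s"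
    "left_lim (\<lambda>s. real (y s)) u = real (y s)"
proof -
  have mono: "y r \<le> y s" if "0 \<le> r" "r \<le> s" for r s
    using assms(1) that by (auto simp: counting_path_def intro: mono_onD)
  have fin: "finite (y ` {0..<u})"
    by (rule finite_subset[of _ "{..y u}"]) (auto intro: mono)
  have "Max (y ` {0..<u}) \<in> y ` {0..<u}"
    using fin \<open>0 < u\<close> by (intro Max_in) auto
  then obtain s where "Max (y ` {0..<u}) = y s" "s \<in> {0..<u}"
    by (rule imageE)
  then have s: "0 \<le> s" "s < u" "y s = Max (y ` {0..<u})"
    by simp_all
  have const: "y r = y s" if "s \<le> r" "r < u" for r
  proof (rule antisym)
    show "y r \<le> y s" unfolding s(3) using fin s that by (intro Max_ge) auto
    show "y s \<le> y r" using mono[of s r] s(1) that by simp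
  qed
  have "((\<lambda>s. real (y s)) \<longlongrightarrow> real (y s)) (at_left u)"
  proof (rule tendsto_eventually)
    show "\<forall>\<^sub>F r in at_left u. real (y r) = real (y s)"
      unfolding eventually_at_left[OF s(2)] using s(2) const[OF less_imp_le] by metis
  qed
  from left_lim_eq[OF this] show ?thesis
    using that[OF s(1,2) const] by blast
qed

lemma dY_jump_times:
  assumes "counting_path y" "0 \<le> a" "u \<in> jump_times y a b"
  shows "dY y u = 1"
proof -
  have "0 < u" "dY y u \<noteq> 0" using assms(2,3) by (auto simp: jump_times_def)
  then show ?thesis using assms(1) unfolding counting_path_def by blast
qed

text \<open>A unit jump at \<open>u\<close> lifts \<open>y u\<close> above every earlier value, so
  \<open>y\<close> is injective on the jump times; its values there are natural numbers bounded by
  \<open>y b\<close>.\<close>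

lemma finite_jump_times:
  assumes "counting_path y" "0 \<le> a"
  shows "finite (jump_times y a b)"
proof (rule finite_imageD)
  have mono: "y r \<le> y s" if "0 \<le> r" "r \<le> s" for r s
    using assms(1) that by (auto simp: counting_path_def intro: mono_onD)
  have "y u \<le> y b" if "u \<in> jump_times y a b" for u
    using mono[of u b] that assms(2) by (simp add: jump_times_def)
  then have "y ` jump_times y a b \<subseteq> {..y b}" by auto
  then show "finite (y ` jump_times y a b)" by (rule finite_subset) simp
  show "inj_on y (jump_times y a b)"
  proof (rule linorder_inj_onI)
    fix r u assume ru: "r < u" "r \<in> jump_times y a b" "u \<in> jump_times y a b"
    then have pos: "0 < r" "0 < u" using assms(2) by (auto simp: jump_times_def)
    obtain s where s: "0 \<le> s" "s < u" "\<And>r. s \<le> r \<Longrightarrow> r < u \<Longrightarrow> y r = y s"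
      "left_lim (\<lambda>s. real (y s)) u = real (y s)"
      using counting_path_left_constant[OF assms(1) pos(2)] by metis
    have "real (y u) - real (y s) = 1"
      using dY_jump_times[OF assms ru(3)] s(4) by (simp add: dY_def)
    moreover have "y r \<le> y s"
      \<comment> \<open>\<open>max r s\<close> lies after \<open>r\<close> and still inside the
        stretch before \<open>u\<close> on which \<open>y\<close> is constant.\<close>
      using s(3)[of "max r s"] mono[of r "max r s"] pos(1) ru(1) s(2) by simp
    ultimately show "y r \<noteq> y u" by simp
  qed auto
qed

section \<open>Products and inverses of diagonal matrices\<close>

text \<open>\<open>matrix_inv\<close> is a choice among two-sided inverses; uniqueness of the
  inverse pins down the chosen matrix.\<close>

lemma matrix_inv_unique:
  fixes A B :: "real^'n^'n"
  assumes "A ** B = mat 1" "B ** A = mat 1"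
  shows "matrix_inv A = B"
proof -
  have "A ** matrix_inv A = mat 1 \<and> matrix_inv A ** A = mat 1"
    unfolding matrix_inv_def by (rule someI[of _ B]) (simp add: assms)
  then have "matrix_inv A = (B ** A) ** matrix_inv A"
    by (simp add: assms)
  also have "\<dots> = B"
    using \<open>A ** matrix_inv A = _ \<and> _\<close> by (simp flip: matrix_mul_assoc)
  finally show ?thesis .
qed

lemma diagm_mult_vector: "(diagm d *v x) $ i = d $ i * x $ i"
proof -
  have "(diagm d *v x) $ i = (\<Sum>j\<in>UNIV. if i = j then d $ i * x $ j else 0)"
    unfolding diagm_def matrix_vector_mult_def vec_lambda_beta by (rule sum.cong) simp_all
  then show ?thesis by simp
qed

lemma diagm_mult: "diagm c ** diagm d = diagm (\<chi> i. c $ i * d $ i)"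
  unfolding matrix_eq vec_eq_iff
  by (simp only: matrix_vector_mul_assoc[symmetric] diagm_mult_vector vec_lambda_beta mult.assoc) simp

lemma diagm_1: "diagm (\<chi> i. 1) = mat 1"
  by (simp add: diagm_def mat_def vec_eq_iff)

lemma matrix_inv_diagm:
  assumes "\<And>i. d $ i \<noteq> 0"
  shows "matrix_inv (diagm d) = diagm (\<chi> i. inverse (d $ i))"
  by (rule matrix_inv_unique) (simp_all add: diagm_mult assms diagm_1)

section \<open>Boundedness, measurability and integrability from one-sided limits\<close>

text \<open>The one-sided limits bound \<open>f\<close> on both sides of each point, and the value
  at the point itself is added to the bound. Bisection glues the local bounds together.\<close>

lemma bounded_of_one_sided_limits:
  fixes f :: "real \<Rightarrow> real"
  assumes right: "\<And>t. t \<in> {a..<b} \<Longrightarrow> \<exists>l. (f \<longlongrightarrow> l) (at_right t)"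
    and left: "\<And>t. t \<in> {a<..b} \<Longrightarrow> \<exists>l. (f \<longlongrightarrow> l) (at_left t)"
  obtains B where "\<And>t. t \<in> {a..b} \<Longrightarrow> \<bar>f t\<bar> \<le> B"
proof (cases "a \<le> b")
  case True
  define P where "P s t \<longleftrightarrow> (\<exists>B. \<forall>r\<in>{s..t} \<inter> {a..b}. \<bar>f r\<bar> \<le> B)" for s t
  have ev: "\<exists>B. eventually (\<lambda>s. \<bar>f s\<bar> \<le> B) F" if "(f \<longlongrightarrow> l) F" for F l
  proof -
    have "eventually (\<lambda>s. dist (f s) l < 1) F" using that by (rule tendstoD) simp
    then have "eventually (\<lambda>s. \<bar>f s\<bar> \<le> \<bar>l\<bar> + 1) F" by eventually_elim (simp add: dist_real_def)
    then show ?thesis ..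
  qed
  from True have "P a b"
  proof (induct rule: Bolzano)
    case (trans r s t)
    then obtain B C where "\<forall>u\<in>{r..s} \<inter> {a..b}. \<bar>f u\<bar> \<le> B" "\<forall>u\<in>{s..t} \<inter> {a..b}. \<bar>f u\<bar> \<le> C"
      unfolding P_def by blast
    then have "\<forall>u\<in>{r..t} \<inter> {a..b}. \<bar>f u\<bar> \<le> max B C"
      by (metis IntD1 IntD2 IntI atLeastAtMost_iff le_max_iff_disj nle_le)
    then show ?case unfolding P_def ..
  next
    case (local x)
    have "\<exists>d>0. \<exists>B. \<forall>s. x < s \<and> s < x + d \<and> s \<le> b \<longrightarrow> \<bar>f s\<bar> \<le> B"
    proof (cases "x < b")
      case True
      then obtain l where "(f \<longlongrightarrow> l) (at_right x)" using right[of x] local by auto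
      then obtain B where "eventually (\<lambda>s. \<bar>f s\<bar> \<le> B) (at_right x)" using ev by blast
      then obtain c where "c > x" "\<forall>s>x. s < c \<longrightarrow> \<bar>f s\<bar> \<le> B"
        using eventually_at_right[of x "x + 1"] by auto
      then show ?thesis by (intro exI[of _ "c - x"] conjI exI[of _ B]) auto
    qed (auto intro: exI[of _ 1])
    then obtain d1 B where 1: "d1 > 0" "\<And>s. x < s \<Longrightarrow> s < x + d1 \<Longrightarrow> s \<le> b \<Longrightarrow> \<bar>f s\<bar> \<le> B" by blast
    have "\<exists>d>0. \<exists>B. \<forall>s. x - d < s \<and> s < x \<and> s \<ge> a \<longrightarrow> \<bar>f s\<bar> \<le> B"
    proof (cases "x > a")
      case True
      then obtain l where "(f \<longlongrightarrow> l) (at_left x)" using left[of x] local by auto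
      then obtain B where "eventually (\<lambda>s. \<bar>f s\<bar> \<le> B) (at_left x)" using ev by blast
      then obtain c where "c < x" "\<forall>s>c. s < x \<longrightarrow> \<bar>f s\<bar> \<le> B"
        using eventually_at_left[of "x - 1" x] by auto
      then show ?thesis by (intro exI[of _ "x - c"] conjI exI[of _ B]) auto
    qed (auto intro: exI[of _ 1])
    then obtain d2 C where 2: "d2 > 0" "\<And>s. x - d2 < s \<Longrightarrow> s < x \<Longrightarrow> s \<ge> a \<Longrightarrow> \<bar>f s\<bar> \<le> C" by blast
    have bd: "\<bar>f r\<bar> \<le> max (max B C) \<bar>f x\<bar>"
      if "s \<le> x" "x \<le> t" "t - s < min d1 d2" "r \<in> {s..t} \<inter> {a..b}" for r s t
    proof -
      consider "r < x" | "r = x" | "r > x" by linarith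
      then show ?thesis
      proof cases
        case 1 then have "\<bar>f r\<bar> \<le> C" using that 2(2)[of r] by auto
        then show ?thesis by simp
      next
        case 3 then have "\<bar>f r\<bar> \<le> B" using that 1(2)[of r] by auto
        then show ?thesis by simp
      qed simp
    qed
    show ?case
      using 1 2 bd unfolding P_def by (intro exI[of _ "min d1 d2"]) (auto intro!: exI[of _ "max (max B C) \<bar>f x\<bar>"])
  qed
  then obtain B where "\<forall>r\<in>{a..b}. \<bar>f r\<bar> \<le> B" unfolding P_def by auto
  then show ?thesis using that by blast
next
  case False
  then show ?thesis using that[of 0] by auto
qed

lemma countable_left_lim_neq:
  fixes f :: "real \<Rightarrow> real"
  assumes left: "\<And>t. t \<in> {a<..b} \<Longrightarrow> \<exists>l. (f \<longlongrightarrow> l) (at_left t)"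
  shows "countable {t \<in> {a<..b}. left_lim f t \<noteq> f t}"
  by (rule countable_subset[OF _ countable_left_discontinuities[of f]]) (use left left_lim_eq in blast)

text \<open>Away from countably many points both one-sided limits equal the value, so
  \<open>f\<close> is continuous there, and changing a function at countably many points preserves
  Borel measurability.\<close>

lemma set_borel_measurable_cadlag:
  fixes f :: "real \<Rightarrow> real"
  assumes right: "\<And>t. t \<in> {a..<b} \<Longrightarrow> continuous (at_right t) f"
    and left: "\<And>t. t \<in> {a<..b} \<Longrightarrow> \<exists>l. (f \<longlongrightarrow> l) (at_left t)"
  shows "set_borel_measurable borel {a<..b} f"
proof -
  \<comment> \<open>The endpoint \<open>b\<close> is removed as well because right-continuity is
    assumed only before \<open>b\<close>.\<close>
  let ?C = "{t \<in> {a<..b}. left_lim f t \<noteq> f t} \<union> {b}"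
  have cC: "countable ?C" using countable_left_lim_neq[OF left] by simp
  have "continuous_on ({a<..b} - ?C) f"
  proof (rule continuous_at_imp_continuous_on, rule ballI)
    fix t assume t: "t \<in> {a<..b} - ?C"
    then obtain l where "(f \<longlongrightarrow> l) (at_left t)" using left[of t] by blast
    moreover from this t have "l = f t" using left_lim_eq[of f l t] by auto
    moreover have "(f \<longlongrightarrow> f t) (at_right t)" using right[of t] t by (auto simp: continuous_within)
    ultimately show "isCont f t" by (auto simp: isCont_def filterlim_at_split)
  qed
  then have "(\<lambda>t. indicator ({a<..b} - ?C) t *\<^sub>R f t) \<in> borel_measurable borel"
    by (intro borel_measurable_continuous_on_indicator sets.Diff sets.countable[OF _ cC]) auto
  then have "(\<lambda>t. indicator {a<..b} t *\<^sub>R f t) \<in> borel_measurable borel"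
    by (rule measurable_discrete_difference[OF _ cC]) (auto simp: indicator_def)
  then show ?thesis unfolding set_borel_measurable_def .
qed

lemma set_integrable_mult_bounded:
  fixes f g :: "real \<Rightarrow> real"
  assumes g: "set_integrable lborel S g" and f: "set_borel_measurable borel S f"
    and B: "\<And>t. t \<in> S \<Longrightarrow> \<bar>f t\<bar> \<le> B"
  shows "set_integrable lborel S (\<lambda>t. g t * f t)"
proof -
  have meas: "set_borel_measurable lborel S (\<lambda>t. g t * f t)"
  proof -
    \<comment> \<open>The indicator equals its square, so it can be attached to each factor
      separately; both factors are measurable only on \<open>S\<close>.\<close>
    have "(\<lambda>t. (indicator S t *\<^sub>R g t) * (indicator S t *\<^sub>R f t)) \<in> borel_measurable borel"
      using f borel_measurable_integrable[OF g[unfolded set_integrable_def]]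
      by (intro borel_measurable_times) (simp_all add: set_borel_measurable_def)
    moreover have "(\<lambda>t. (indicator S t *\<^sub>R g t) * (indicator S t *\<^sub>R f t)) = (\<lambda>t. indicator S t *\<^sub>R (g t * f t))"
      by (auto simp: indicator_def)
    ultimately show ?thesis by (simp add: set_borel_measurable_def)
  qed
  have "set_integrable lborel S (\<lambda>t. B * g t)" using g by simp
  then show ?thesis
  proof (rule set_integrable_bound[OF _ meas])
    show "AE t in lborel. t \<in> S \<longrightarrow> norm (g t * f t) \<le> norm (B * g t)"
    proof (rule AE_I2, rule impI)
      fix t assume "t \<in> S"
      then have "\<bar>f t\<bar> \<le> \<bar>B\<bar>" using B[of t] by simp
      from mult_right_mono[OF this, of "\<bar>g t\<bar>"]
      show "norm (g t * f t) \<le> norm (B * g t)" by (simp add: abs_mult mult.commute)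
    qed
  qed
qed

section \<open>Coordinates of vector integrals and indefinite integrals\<close>

lemma set_integrable_vec:
  fixes f :: "real \<Rightarrow> real^'n"
  assumes "\<And>i. set_integrable M S (\<lambda>t. f t $ i)"
  shows "set_integrable M S f"
proof -
  have "integrable M (\<lambda>t. \<Sum>i\<in>UNIV. (indicator S t *\<^sub>R f t $ i) *\<^sub>R (axis i 1 :: real^'n))"
    using assms by (intro Bochner_Integration.integrable_sum integrable_scaleR_left) (simp add: set_integrable_def)
  also have "(\<lambda>t. \<Sum>i\<in>UNIV. (indicator S t *\<^sub>R f t $ i) *\<^sub>R (axis i 1 :: real^'n)) = (\<lambda>t. indicator S t *\<^sub>R f t)"
    by (auto simp: vec_eq_iff axis_def if_distrib[of "\<lambda>c. _ * c"] cong: if_cong)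
  finally show ?thesis by (simp add: set_integrable_def)
qed

lemma set_lebesgue_integral_vec_nth:
  fixes f :: "real \<Rightarrow> real^'n"
  assumes "\<And>i. set_integrable M S (\<lambda>t. f t $ i)"
  shows "set_lebesgue_integral M S f $ i = set_lebesgue_integral M S (\<lambda>t. f t $ i)"
  using integral_bounded_linear[OF bounded_linear_vec_nth[of i] set_integrable_vec[OF assms, unfolded set_integrable_def]]
  by (simp add: set_lebesgue_integral_def)

lemma indefinite_integral_diff:
  fixes f :: "real \<Rightarrow> real"
  assumes "set_integrable lborel {a<..b} f" "a \<le> s" "s \<le> t" "t \<le> b"
  shows "set_lebesgue_integral lborel {a<..t} f - set_lebesgue_integral lborel {a<..s} f
    = set_lebesgue_integral lborel {s<..t} f"
proof -
  have "{a<..t} = {a<..s} \<union> {s<..t}" using assms by auto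
  moreover have "set_integrable lborel {a<..s} f" "set_integrable lborel {s<..t} f"
    by (rule set_integrable_subset[OF assms(1)]; use assms in auto)+
  ultimately have "set_lebesgue_integral lborel {a<..t} f
      = set_lebesgue_integral lborel {a<..s} f + set_lebesgue_integral lborel {s<..t} f"
    by (simp only:) (rule set_integral_Un; auto)
  then show ?thesis by simp
qed

text \<open>The Lebesgue integral agrees with the gauge integral, whose indefinite integral is
  continuous; passing from \<open>{a<..t}\<close> to \<open>{a..t}\<close> only adds the negligible
  point \<open>a\<close>.\<close>

lemma continuous_on_indefinite_integral:
  fixes f :: "real \<Rightarrow> real"
  assumes "set_integrable lborel {a<..b} f"
  shows "continuous_on {a..b} (\<lambda>t. set_lebesgue_integral lborel {a<..t} f)"
proof -
  have int: "f integrable_on {a<..b}"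
    using set_borel_integral_eq_integral(1)[OF assms] .
  then have "f integrable_on {a..b}"
    by (rule integrable_spike_set) (auto intro: negligible_subset[of "{a}"])
  then have "continuous_on {a..b} (\<lambda>t. integral {a..t} f)"
    by (rule indefinite_integral_continuous_1)
  moreover have "integral {a..t} f = set_lebesgue_integral lborel {a<..t} f" if "t \<in> {a..b}" for t
  proof -
    have "set_lebesgue_integral lborel {a<..t} f = integral {a<..t} f"
      by (rule set_borel_integral_eq_integral(2)[OF set_integrable_subset[OF assms]]) (use that in auto)
    also have "\<dots> = integral {a..t} f"
      by (rule integral_spike_set) (auto intro: negligible_subset[of "{a}"])
    finally show ?thesis by simp
  qed
  ultimately show ?thesis by (rule continuous_on_eq)
qed

section \<open>The scalar integrating factor\<close>

lemma mult_near:
  fixes a b e :: real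
  assumes "e > 0"
  obtains d where "d > 0" "\<And>x y. \<bar>x - a\<bar> < d \<Longrightarrow> \<bar>y - b\<bar> < d \<Longrightarrow> \<bar>x * y - a * b\<bar> < e"
proof -
  \<comment> \<open>The bound 1 gives \<open>\<bar>y\<bar> \<le> \<bar>b\<bar> + 1\<close>; the
    other bound makes the total error \<open>d * (\<bar>a\<bar> + \<bar>b\<bar> + 1)\<close> at most
    \<open>e\<close>.\<close>
  define d where "d = min 1 (e / (\<bar>a\<bar> + \<bar>b\<bar> + 1))"
  have "d > 0" using assms by (auto simp: d_def intro!: divide_pos_pos)
  moreover have "\<bar>x * y - a * b\<bar> < e" if "\<bar>x - a\<bar> < d" "\<bar>y - b\<bar> < d" for x y
  proof -
    have "x * y - a * b = (x - a) * y + a * (y - b)" by (simp add: algebra_simps)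
    then have "\<bar>x * y - a * b\<bar> \<le> \<bar>x - a\<bar> * \<bar>y\<bar> + \<bar>a\<bar> * \<bar>y - b\<bar>"
      by (simp add: abs_mult[symmetric])
    also have "\<dots> \<le> \<bar>x - a\<bar> * (\<bar>b\<bar> + 1) + \<bar>a\<bar> * d"
      using that by (intro add_mono mult_left_mono) (simp_all add: d_def, arith)
    also have "\<dots> < d * (\<bar>b\<bar> + 1) + \<bar>a\<bar> * d"
      using that by (intro add_strict_right_mono mult_strict_right_mono) auto
    also have "\<dots> = d * (\<bar>a\<bar> + \<bar>b\<bar> + 1)" by (simp add: algebra_simps)
    also have "\<dots> \<le> e"
    proof -
      have "d \<le> e / (\<bar>a\<bar> + \<bar>b\<bar> + 1)" by (simp add: d_def)
      then show ?thesis by (subst (asm) pos_le_divide_eq) auto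
    qed
    finally show ?thesis .
  qed
  ultimately show ?thesis by (rule that)
qed

text \<open>The coefficients \<open>m\<close>, \<open>h\<close>, \<open>a\<close> are left free so
  that one statement serves every coordinate of both filter and smoother. At \<open>u\<close> in
  \<open>J\<close> the equation forces \<open>x u = m u * xl u\<close>, which the factor
  \<open>inverse (m u)\<close> entering \<open>Q\<close> undoes; \<open>E\<close> removes the drift
  \<open>- h * x\<close> between jumps.\<close>

lemma integrating_factor:
  fixes x xl h a m E Q :: "real \<Rightarrow> real" and J :: "real set"
  assumes J: "finite J" "J \<subseteq> {0<..T}" and m: "\<And>u. u \<in> J \<Longrightarrow> m u > 0"
    and xl: "\<And>u. u \<in> J \<Longrightarrow> (x \<longlongrightarrow> xl u) (at_left u)"
    and h: "set_integrable lborel {0<..T} h"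
    and a: "set_integrable lborel {0<..T} a"
    and hx: "set_integrable lborel {0<..T} (\<lambda>u. h u * x u)"
    and eq: "\<And>t. t \<in> {0..T} \<Longrightarrow> x t = x 0 + (\<Sum>u\<in>{u\<in>J. u \<le> t}. (m u - 1) * xl u)
        - set_lebesgue_integral lborel {0<..t} (\<lambda>u. h u * x u) + set_lebesgue_integral lborel {0<..t} a"
  defines "E \<equiv> \<lambda>t. exp (set_lebesgue_integral lborel {0<..t} h)"
    and "Q \<equiv> \<lambda>t. \<Prod>u\<in>{u\<in>J. u \<le> t}. inverse (m u)"
  shows "set_integrable lborel {0<..T} (\<lambda>u. E u * Q u * a u)" (is ?int)
    and "\<And>t. t \<in> {0..T} \<Longrightarrow>
      E t * Q t * x t = x 0 + set_lebesgue_integral lborel {0<..t} (\<lambda>u. E u * Q u * a u)"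
proof -
  define I where "I f t = set_lebesgue_integral lborel {0<..t} f" for f :: "real \<Rightarrow> real" and t
  \<comment> \<open>\<open>c\<close> is the continuous part of \<open>x\<close>: on stretches
    without jumps, \<open>x\<close> and \<open>c\<close> have the same increments.\<close>
  define c where "c t = I a t - I (\<lambda>u. h u * x u) t" for t
  define D where "D s t = {u\<in>J. s < u \<and> u \<le> t}" for s t
  define b where "b u = (m u - 1) * xl u" for u
  have contI: "continuous_on {0..T} (I f)" if "set_integrable lborel {0<..T} f" for f
    unfolding I_def using that by (rule continuous_on_indefinite_integral)
  have contE: "continuous_on {0..T} E"
    unfolding E_def using contI[OF h] by (intro continuous_intros) (simp add: I_def)
  have contc: "continuous_on {0..T} c"
    unfolding c_def by (intro continuous_intros contI a hx)
  have diffI: "I f t - I f s = set_lebesgue_integral lborel {s<..t} f"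
    if "set_integrable lborel {0<..T} f" "0 \<le> s" "s \<le> t" "t \<le> T" for f s t
    unfolding I_def using indefinite_integral_diff that by blast
  have split: "{u\<in>J. u \<le> t} = {u\<in>J. u \<le> s} \<union> D s t" "{u\<in>J. u \<le> s} \<inter> D s t = {}" if "s \<le> t" for s t
    using that by (auto simp: D_def)
  have finD: "finite (D s t)" for s t using J by (simp add: D_def)
  have x_diff: "x t - x s = sum b (D s t) + (c t - c s)" if "0 \<le> s" "s \<le> t" "t \<le> T" for s t
    using eq[of s] eq[of t] that split[OF that(2)] J finD
    by (simp add: sum.union_disjoint c_def I_def b_def)
  have Q_mult: "Q t = Q s * (\<Prod>u\<in>D s t. inverse (m u))" if "s \<le> t" for s t
    unfolding Q_def split(1)[OF that] using J finD split(2)[OF that] by (intro prod.union_disjoint) auto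
  have Q_pos: "Q t > 0" for t
    unfolding Q_def using m by (intro prod_pos) auto
  have E_pos: "E t > 0" for t by (simp add: E_def)

  \<comment> \<open>With a fixed index set and the dependence on \<open>t\<close> moved into the
    factors, \<open>Q\<close> is visibly a finite product of measurable step functions.\<close>
  have Q_alt: "Q t = (\<Prod>u\<in>J. if u \<le> t then inverse (m u) else 1)" for t
    unfolding Q_def using J by (simp add: prod.inter_filter)
  show int: ?int
  proof -
    obtain B where B: "\<forall>t\<in>{0..T}. \<bar>E t\<bar> \<le> B"
      using compact_imp_bounded[OF compact_continuous_image[OF contE compact_Icc]]
      by (auto simp: bounded_iff)
    have "continuous_on {0<..T} E" using contE by (rule continuous_on_subset) auto
    then have "set_borel_measurable borel {0<..T} E"
      unfolding set_borel_measurable_def by (rule borel_measurable_continuous_on_indicator[rotated]) simp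
    then have aE: "set_integrable lborel {0<..T} (\<lambda>u. a u * E u)"
      by (rule set_integrable_mult_bounded[OF a]) (use B in auto)
    have "Q \<in> borel_measurable borel"
      unfolding Q_alt[abs_def] by measurable
    then have "set_borel_measurable borel {0<..T} Q"
      unfolding set_borel_measurable_def by measurable
    moreover have "bounded (range Q)"
    proof (rule finite_imp_bounded, rule finite_subset)
      \<comment> \<open>\<open>Q\<close> takes at most one value per subset of \<open>J\<close>,
        hence it is bounded.\<close>
      show "range Q \<subseteq> (\<lambda>S. \<Prod>u\<in>S. inverse (m u)) ` Pow J" by (auto simp: Q_def)
    qed (use J in simp)
    then obtain C where "\<And>t. \<bar>Q t\<bar> \<le> C" by (auto simp: bounded_iff)
    ultimately have "set_integrable lborel {0<..T} (\<lambda>u. a u * E u * Q u)"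
      by (intro set_integrable_mult_bounded[OF aE])
    then show ?thesis by (simp add: mult_ac)
  qed

  define k where "k u = \<bar>h u\<bar> + \<bar>a u\<bar>" for u
  have k: "set_integrable lborel {0<..T} k"
    unfolding k_def using h a by (intro set_integral_add(1) set_integrable_abs)
  \<comment> \<open>Counting a jump at \<open>u\<close> once on each side makes \<open>K\<close> increase by at least 1 over every
    nondegenerate interval containing \<open>u\<close>, even as an endpoint; continuity of \<open>W\<close> then suffices there.\<close>
  define n where "n u t = (if u \<le> t then 1 else 0) + (if u < t then 1 else 0 :: real)" for u t :: real
  define K where "K t = I k t + (\<Sum>u\<in>J. n u t)" for t
  define W where "W t = E t * Q t * x t - I (\<lambda>u. E u * Q u * a u) t" for t
  have K_ge: "I k t - I k s \<le> K t - K s" if "s \<le> t" for s t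
    unfolding K_def using that by (auto intro!: sum_mono simp: n_def)
  have Ik_mono: "0 \<le> I k t - I k s" if "0 \<le> s" "s \<le> t" "t \<le> T" for s t
    unfolding diffI[OF k that] set_lebesgue_integral_def
    by (rule Bochner_Integration.integral_nonneg) (simp add: k_def)
  \<comment> \<open>All other points of \<open>J\<close> keep distance \<open>d\<close> from
    \<open>x0\<close>. Since \<open>D\<close> excludes its left endpoint, \<open>D x0 t\<close> is
    empty even if \<open>x0\<close> is a jump time.\<close>
  have near: "\<exists>d>0. \<forall>s t. x0 - d < s \<and> s \<le> x0 \<and> x0 \<le> t \<and> t < x0 + d \<longrightarrow> D s t \<subseteq> {x0} \<and> D x0 t = {}" for x0
  proof -
    obtain d where "d > 0" "\<And>u. u \<in> J \<Longrightarrow> u \<noteq> x0 \<Longrightarrow> d \<le> dist x0 u"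
      using finite_set_avoid[OF J(1)] by metis
    then show ?thesis by (intro exI[of _ d]) (force simp: D_def dist_real_def)
  qed
  have loc: "\<exists>d>0. \<forall>s t. 0 \<le> s \<and> s \<le> x0 \<and> x0 \<le> t \<and> t \<le> T \<and> t - s < d \<longrightarrow> \<bar>W t - W s\<bar> \<le> e * (K t - K s)"
    if "e > 0" and x0: "x0 \<in> {0..T}" for e x0
  proof (cases "x0 \<in> J")
    case True
    obtain d where d: "d > 0" "\<And>s t. x0 - d < s \<Longrightarrow> s \<le> x0 \<Longrightarrow> x0 \<le> t \<Longrightarrow> t < x0 + d \<Longrightarrow> D s t \<subseteq> {x0} \<and> D x0 t = {}"
      using near by meson
    have "0 < x0" using True J by auto
    have D0: "D s x0 = {x0}" if "x0 - d < s" "s < x0" for s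
      using d(2)[of s x0] that d(1) True by (auto simp: D_def)
    have x_left: "x s = x x0 - b x0 + (c s - c x0)" if "x0 - d < s" "s < x0" "0 \<le> s" for s
      using x_diff[of s x0] D0[of s] that x0 by simp
    \<comment> \<open>Letting \<open>s\<close> increase to \<open>x0\<close> in
      \<open>x_left\<close> gives a second expression for the left limit of \<open>x\<close>, since
      \<open>c\<close> is continuous.\<close>
    have "x x0 - b x0 = xl x0"
    proof (rule tendsto_unique)
      have "continuous_on {0..x0} c" using contc by (rule continuous_on_subset) (use x0 in auto)
      then have "(c \<longlongrightarrow> c x0) (at_left x0)"
        using \<open>0 < x0\<close> by (auto simp: continuous_on_def at_within_Icc_at_left dest: bspec[where x = x0])
      then have "((\<lambda>s. x x0 - b x0 + (c s - c x0)) \<longlongrightarrow> x x0 - b x0 + (c x0 - c x0)) (at_left x0)"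
        by (intro tendsto_intros)
      moreover have "\<forall>\<^sub>F s in at_left x0. x x0 - b x0 + (c s - c x0) = x s"
        unfolding eventually_at_left[OF \<open>0 < x0\<close>]
        by (rule exI[of _ "max 0 (x0 - d)"]) (use x_left d(1) \<open>0 < x0\<close> in auto)
      ultimately show "(x \<longlongrightarrow> x x0 - b x0) (at_left x0)"
        by (simp add: tendsto_cong)
    qed (use xl[OF True] in auto)
    then have x_jump: "x x0 = m x0 * xl x0" by (simp add: b_def algebra_simps)
    \<comment> \<open>\<open>V r\<close> is a continuous version of \<open>W\<close> near
      \<open>x0\<close>: \<open>r = 1\<close> describes the right side, and \<open>r = m x0\<close>
      the left side, where \<open>Q\<close> has not yet received the factor
      \<open>inverse (m x0)\<close> and \<open>x\<close> has not yet been multiplied by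
      \<open>m x0\<close>. At \<open>x0\<close> the factor \<open>r\<close> cancels, so both
      versions agree with \<open>W x0\<close>.\<close>
    define V where "V r t = E t * Q x0 * r * (x x0 / r + (c t - c x0)) - I (\<lambda>u. E u * Q u * a u) t" for r t
    have contV: "continuous_on {0..T} (V r)" for r
      unfolding V_def by (intro continuous_intros contE contc contI[OF int])
    have near_V: "\<exists>d>0. \<forall>t\<in>{0..T}. \<bar>t - x0\<bar> < d \<longrightarrow> \<bar>V r t - V r x0\<bar> < e / 2" for r
      using contV[of r] x0 \<open>e > 0\<close> unfolding continuous_on_iff dist_real_def by (meson half_gt_zero)
    obtain d1 where d1: "d1 > 0" "\<And>t. t \<in> {0..T} \<Longrightarrow> \<bar>t - x0\<bar> < d1 \<Longrightarrow> \<bar>V 1 t - V 1 x0\<bar> < e / 2"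
      using near_V[of 1] by blast
    obtain d2 where d2: "d2 > 0" "\<And>t. t \<in> {0..T} \<Longrightarrow> \<bar>t - x0\<bar> < d2 \<Longrightarrow> \<bar>V (m x0) t - V (m x0) x0\<bar> < e / 2"
      using near_V[of "m x0"] by blast
    have m0: "m x0 > 0" using m True by simp
    have W0: "W x0 = V 1 x0" "W x0 = V (m x0) x0" using m0 by (simp_all add: W_def V_def)
    have Wt: "W t = V 1 t" if "x0 \<le> t" "t < x0 + d" "t \<le> T" for t
    proof -
      have "D x0 t = {}" using d(2)[of x0 t] d(1) that by auto
      then have "Q t = Q x0" "x t = x x0 + (c t - c x0)"
        using x_diff[of x0 t] Q_mult[of x0 t] that x0 by simp_all
      then show ?thesis by (simp add: W_def V_def)
    qed
    have Ws: "W s = V (m x0) s" if "x0 - d < s" "s < x0" "0 \<le> s" for s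
    proof -
      have "Q s = Q x0 * m x0" using Q_mult[of s x0] D0[of s] that m0 by simp
      moreover have "x s = x x0 / m x0 + (c s - c x0)"
        using x_left[OF that] \<open>x x0 - b x0 = xl x0\<close> x_jump m0 by simp
      ultimately show ?thesis by (simp add: W_def V_def)
    qed
    \<comment> \<open>Each side of \<open>x0\<close> contributes less than \<open>e / 2\<close>,
      while \<open>K\<close> grows by at least 1 as soon as \<open>s < t\<close>.\<close>
    have "\<bar>W t - W s\<bar> \<le> e * (K t - K s)"
      if st: "0 \<le> s" "s \<le> x0" "x0 \<le> t" "t \<le> T" "t - s < min d (min d1 d2)" for s t
    proof (cases "s = t")
      case False
      have "\<bar>W t - W x0\<bar> < e / 2"
        using d1(2)[of t] Wt[of t] W0(1) st x0 by auto
      moreover have "\<bar>W s - W x0\<bar> < e / 2"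
      proof (cases "s = x0")
        case False
        then show ?thesis using d2(2)[of s] Ws[of s] W0(2) st x0 by auto
      qed (use \<open>e > 0\<close> in simp)
      ultimately have "\<bar>W t - W s\<bar> \<le> e * 1" by linarith
      also have "1 \<le> K t - K s"
      proof -
        have "1 \<le> n x0 t - n x0 s" using st False by (auto simp: n_def)
        also have "\<dots> \<le> (\<Sum>u\<in>J. n u t - n u s)"
          using st J True by (intro member_le_sum) (auto simp: n_def)
        finally show ?thesis using Ik_mono[of s t] st by (simp add: K_def sum_subtractf)
      qed
      then have "e * 1 \<le> e * (K t - K s)" using \<open>e > 0\<close> by (intro mult_left_mono) auto
      finally show ?thesis .
    qed simp
    then show ?thesis using d(1) d1(1) d2(1) by (intro exI[of _ "min d (min d1 d2)"]) auto
  next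
    case False
    obtain d where d: "d > 0" "\<And>s t. x0 - d < s \<Longrightarrow> s \<le> x0 \<Longrightarrow> x0 \<le> t \<Longrightarrow> t < x0 + d \<Longrightarrow> D s t \<subseteq> {x0} \<and> D x0 t = {}"
      using near by meson
    have D0: "D s t = {}" if "x0 - d < s" "s \<le> x0" "x0 \<le> t" "t < x0 + d" for s t
      using d(2)[OF that] False by (auto simp: D_def)
    \<comment> \<open>Without a jump nearby, \<open>Q\<close> stays equal to the constant
      \<open>p\<close>, and \<open>x\<close> moves only with \<open>c\<close>.\<close>
    define p where "p = Q x0"
    have "p > 0" using Q_pos by (simp add: p_def)
    have Qp: "Q u = p" and xc: "x u = x x0 + (c u - c x0)" if "x0 - d < u" "u < x0 + d" "0 \<le> u" "u \<le> T" for u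
    proof -
      consider "u \<le> x0" | "x0 \<le> u" by linarith
      then have "Q u = p \<and> x u = x x0 + (c u - c x0)"
      proof cases
        case 1
        then have "D u x0 = {}" using D0[of u x0] that d(1) by simp
        then show ?thesis using x_diff[of u x0] Q_mult[of u x0] 1 that x0 by (simp add: p_def)
      next
        case 2
        then have "D x0 u = {}" using D0[of x0 u] that d(1) by simp
        then show ?thesis using x_diff[of x0 u] Q_mult[of x0 u] 2 that x0 by (simp add: p_def)
      qed
      then show "Q u = p" "x u = x x0 + (c u - c x0)" by auto
    qed
    \<comment> \<open>Dividing by \<open>p\<close> compensates for the constant factor
      \<open>Q = p\<close> in the increments of \<open>W\<close>.\<close>
    define e1 where "e1 = e / p"
    have "e1 > 0" using \<open>e > 0\<close> \<open>p > 0\<close> by (simp add: e1_def)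
    then obtain d1 where d1: "d1 > 0" "\<And>\<alpha> \<beta>. \<bar>\<alpha> - x x0\<bar> < d1 \<Longrightarrow> \<bar>\<beta> - E x0\<bar> < d1 \<Longrightarrow> \<bar>\<alpha> * \<beta> - x x0 * E x0\<bar> < e1 / 2"
      using mult_near[of "e1 / 2"] by (metis half_gt_zero)
    \<comment> \<open>\<open>d1\<close> keeps the products of values of \<open>x\<close> and
      \<open>E\<close> within \<open>e1 / 2\<close> of \<open>x x0 * E x0\<close>;
      \<open>e1 / 2\<close> keeps two values of \<open>E\<close> within \<open>e1\<close> of each
      other.\<close>
    define \<eta> where "\<eta> = min d1 (e1 / 2)"
    have "\<eta> > 0" using d1(1) \<open>e1 > 0\<close> by (simp add: \<eta>_def)
    then obtain d2 where d2: "d2 > 0" "\<And>u. u \<in> {0..T} \<Longrightarrow> \<bar>u - x0\<bar> < d2 \<Longrightarrow> \<bar>E u - E x0\<bar> < \<eta>"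
      using contE x0 unfolding continuous_on_iff dist_real_def by meson
    obtain d3 where d3: "d3 > 0" "\<And>u. u \<in> {0..T} \<Longrightarrow> \<bar>u - x0\<bar> < d3 \<Longrightarrow> \<bar>c u - c x0\<bar> < \<eta>"
      using contc x0 \<open>\<eta> > 0\<close> unfolding continuous_on_iff dist_real_def by meson
    have "\<bar>W t - W s\<bar> \<le> e * (K t - K s)"
      if st: "0 \<le> s" "s \<le> x0" "x0 \<le> t" "t \<le> T" "t - s < min d (min d2 d3)" for s t
    proof -
      have u: "Q u = p" "\<bar>x u - x x0\<bar> < \<eta>" "\<bar>E u - E x0\<bar> < \<eta>" if "u \<in> {s..t}" for u
        using Qp[of u] xc[of u] d2(2)[of u] d3(2)[of u] that st by auto
      \<comment> \<open>The mean value theorem is applied to \<open>exp\<close> between the numbers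
        \<open>I h s\<close> and \<open>I h t\<close>, not to \<open>E\<close> as a function of
        time, because \<open>I h\<close> need not be differentiable. Both orders of these numbers
        can occur, as \<open>h\<close> has no sign.\<close>
      have "\<exists>z. min (E s) (E t) \<le> z \<and> z \<le> max (E s) (E t) \<and> E t - E s = z * (I h t - I h s)"
      proof -
        have mv: "\<exists>z. exp y1 \<le> z \<and> z \<le> exp y2 \<and> exp y2 - exp y1 = z * (y2 - y1)" if "y1 \<le> y2" for y1 y2 :: real
        proof (cases "y1 = y2")
          case False
          then have "y1 < y2" using that by simp
          then obtain z where "y1 < z" "z < y2" "exp y2 - exp y1 = (y2 - y1) * exp z"
            using MVT2[of y1 y2 exp exp] DERIV_exp by blast
          then show ?thesis by (intro exI[of _ "exp z"]) auto
        qed auto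
        show ?thesis
        proof (cases "I h s \<le> I h t")
          case True
          then obtain z where "exp (I h s) \<le> z" "z \<le> exp (I h t)" "exp (I h t) - exp (I h s) = z * (I h t - I h s)"
            using mv by blast
          then show ?thesis by (intro exI[of _ z]) (auto simp: E_def I_def)
        next
          case False
          then obtain z where "exp (I h t) \<le> z" "z \<le> exp (I h s)" "exp (I h s) - exp (I h t) = z * (I h s - I h t)"
            using mv[of "I h t" "I h s"] by auto
          then show ?thesis by (intro exI[of _ z]) (auto simp: E_def I_def algebra_simps)
        qed
      qed
      then obtain z where z: "min (E s) (E t) \<le> z" "z \<le> max (E s) (E t)" "E t - E s = z * (I h t - I h s)" by blast
      have zE: "\<bar>z - E x0\<bar> < \<eta>" using z(1,2) u(3)[of s] u(3)[of t] st by auto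
      have sub: "set_integrable lborel {s<..t} f" if "set_integrable lborel {0<..T} f" for f :: "real \<Rightarrow> real"
        by (rule set_integrable_subset[OF that]) (use st in auto)
      \<comment> \<open>\<open>w\<close> is the density of the increment of \<open>W\<close>: the
        discrete product rule \<open>x t * (E t - E s) + E s * (x t - x s)\<close> is exact, and
        \<open>z\<close> turns its first term into an integral of \<open>h\<close>.\<close>
      define w where "w u = p * (x t * z * h u + E s * (a u - h u * x u)) - E u * Q u * a u" for u
      have ax: "set_integrable lborel {0<..T} (\<lambda>u. a u - h u * x u)"
        using a hx by (rule set_integral_diff(1))
      have i1: "set_integrable lborel {0<..T} (\<lambda>u. x t * z * h u)" and i2: "set_integrable lborel {0<..T} (\<lambda>u. E s * (a u - h u * x u))"
        using h ax by auto
      have i3: "set_integrable lborel {0<..T} (\<lambda>u. p * (x t * z * h u + E s * (a u - h u * x u)))"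
        by (intro set_integrable_mult_right set_integral_add(1)[OF i1 i2])
      have w: "set_integrable lborel {0<..T} w"
        unfolding w_def by (rule set_integral_diff(1)[OF i3 int])
      have "W t - W s = p * (E t * x t - E s * x s) - (I (\<lambda>u. E u * Q u * a u) t - I (\<lambda>u. E u * Q u * a u) s)"
        using u(1)[of s] u(1)[of t] st by (simp add: W_def algebra_simps)
      also have "E t * x t - E s * x s = x t * z * (I h t - I h s) + E s * (c t - c s)"
      proof -
        have "x t - x s = c t - c s" using xc[of t] xc[of s] st by simp
        moreover have "E t * x t - E s * x s = x t * (E t - E s) + E s * (x t - x s)" by (simp add: algebra_simps)
        ultimately show ?thesis using z(3) by simp
      qed
      also have "c t - c s = set_lebesgue_integral lborel {s<..t} (\<lambda>u. a u - h u * x u)"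
        unfolding set_integral_diff(2)[OF sub[OF a] sub[OF hx]] using diffI[OF a, of s t] diffI[OF hx, of s t] st
        by (simp add: c_def)
      also have "I h t - I h s = set_lebesgue_integral lborel {s<..t} h"
        using diffI[OF h] st by simp
      also have "I (\<lambda>u. E u * Q u * a u) t - I (\<lambda>u. E u * Q u * a u) s = set_lebesgue_integral lborel {s<..t} (\<lambda>u. E u * Q u * a u)"
        using diffI[OF int] st by simp
      also have "p * (x t * z * set_lebesgue_integral lborel {s<..t} h + E s * set_lebesgue_integral lborel {s<..t} (\<lambda>u. a u - h u * x u))
          - set_lebesgue_integral lborel {s<..t} (\<lambda>u. E u * Q u * a u) = set_lebesgue_integral lborel {s<..t} w"
        unfolding w_def set_integral_diff(2)[OF sub[OF i3] sub[OF int]] set_integral_mult_right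
          set_integral_add(2)[OF sub[OF i1] sub[OF i2]] ..
      finally have "\<bar>W t - W s\<bar> = \<bar>set_lebesgue_integral lborel {s<..t} w\<bar>" by simp
      also have "\<dots> \<le> set_lebesgue_integral lborel {s<..t} (\<lambda>u. \<bar>w u\<bar>)"
        using set_integral_norm_bound[OF sub[OF w]] by simp
      also have "\<dots> \<le> set_lebesgue_integral lborel {s<..t} (\<lambda>u. e * k u)"
      proof (rule set_integral_mono)
        fix u assume "u \<in> {s<..t}"
        then have us: "u \<in> {s..t}" by simp
        have "\<bar>E s - E x0\<bar> < e1 / 2" "\<bar>E u - E x0\<bar> < e1 / 2"
          using u(3)[of s] u(3)[OF us] st by (auto simp: \<eta>_def)
        then have "\<bar>E s - E u\<bar> \<le> e1" by linarith
        then have A: "\<bar>(E s - E u) * a u\<bar> \<le> e1 * \<bar>a u\<bar>"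
          by (simp add: abs_mult mult_right_mono)
        have "\<bar>x t * z - x x0 * E x0\<bar> < e1 / 2" using u(2)[of t] zE st by (intro d1(2)) (auto simp: \<eta>_def)
        moreover have "\<bar>x u * E s - x x0 * E x0\<bar> < e1 / 2" using u(2)[OF us] u(3)[of s] st by (intro d1(2)) (auto simp: \<eta>_def)
        ultimately have "\<bar>x t * z - x u * E s\<bar> \<le> e1" by linarith
        then have H: "\<bar>(x t * z - x u * E s) * h u\<bar> \<le> e1 * \<bar>h u\<bar>"
          by (simp add: abs_mult mult_right_mono)
        \<comment> \<open>Regrouped by \<open>a u\<close> and \<open>h u\<close>, both coefficients
          are differences of nearby values, hence at most \<open>e1\<close>.\<close>
        have "w u = p * ((E s - E u) * a u + (x t * z - x u * E s) * h u)"
          using u(1)[OF us] by (simp add: w_def algebra_simps)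
        then have "\<bar>w u\<bar> = p * \<bar>(E s - E u) * a u + (x t * z - x u * E s) * h u\<bar>"
          using \<open>p > 0\<close> by (simp add: abs_mult)
        also have "\<dots> \<le> p * (e1 * k u)"
          using A H \<open>p > 0\<close> by (intro mult_left_mono) (simp_all add: k_def algebra_simps)
        also have "\<dots> = e * k u" using \<open>p > 0\<close> by (simp add: e1_def)
        finally show "\<bar>w u\<bar> \<le> e * k u" .
      qed (use sub[OF w] sub[OF k] in \<open>auto intro: set_integrable_abs\<close>)
      also have "\<dots> = e * (I k t - I k s)" using diffI[OF k, of s t] st by simp
      also have "\<dots> \<le> e * (K t - K s)" using K_ge[of s t] st \<open>e > 0\<close> by (intro mult_left_mono) auto
      finally show ?thesis .
    qed
    then show ?thesis using d(1) d2(1) d3(1) by (intro exI[of _ "min d (min d2 d3)"]) auto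
  qed
  show "E t * Q t * x t = x 0 + set_lebesgue_integral lborel {0<..t} (\<lambda>u. E u * Q u * a u)"
    if t: "t \<in> {0..T}" for t
  proof -
    have "W t = W 0"
    proof (rule eq_if_increments_locally_small[of 0 t W K])
      fix e x0 :: real assume "e > 0" "x0 \<in> {0..t}"
      then obtain d where "d > 0" "\<And>s r. 0 \<le> s \<Longrightarrow> s \<le> x0 \<Longrightarrow> x0 \<le> r \<Longrightarrow> r \<le> T \<Longrightarrow> r - s < d \<Longrightarrow> \<bar>W r - W s\<bar> \<le> e * (K r - K s)"
        using loc[of e x0] t by auto
      then show "\<exists>d>0. \<forall>s r. 0 \<le> s \<and> s \<le> x0 \<and> x0 \<le> r \<and> r \<le> t \<and> r - s < d \<longrightarrow> \<bar>W r - W s\<bar> \<le> e * (K r - K s)"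
        using t by (intro exI[of _ d]) auto
    qed (use t in simp)
    moreover have "{u\<in>J. u \<le> 0} = {}" using J by auto
    then have "Q 0 = 1" unfolding Q_def by (simp only: prod.empty)
    then have "W 0 = x 0" by (simp add: W_def E_def I_def set_lebesgue_integral_def)
    ultimately show ?thesis by (simp add: W_def I_def)
  qed
qed

section \<open>Left limits and cadlag factors under the integral\<close>

text \<open>In each coordinate, left limit and value differ at countably many points only; the union
  over the finitely many coordinates is still a null set.\<close>

lemma set_integral_left_lim:
  fixes x :: "real \<Rightarrow> real^'n" and G :: "real \<Rightarrow> real^'n \<Rightarrow> 'b::{banach, second_countable_topology}"
  assumes left: "\<And>t. t \<in> {a<..b} \<Longrightarrow> \<exists>l. (x \<longlongrightarrow> l) (at_left t)" and S: "S \<subseteq> {a<..b}"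
  shows "set_lebesgue_integral lborel S (\<lambda>u. G u (left_lim x u)) = set_lebesgue_integral lborel S (\<lambda>u. G u (x u))"
proof -
  have nth: "((\<lambda>s. x s $ i) \<longlongrightarrow> left_lim x t $ i) (at_left t)" if "t \<in> {a<..b}" for t i
    using left[OF that] left_lim_eq tendsto_vec_nth by metis
  have "countable (\<Union>i. {t \<in> {a<..b}. left_lim (\<lambda>s. x s $ i) t \<noteq> x t $ i})"
    using nth by (intro countable_UN countable_left_lim_neq) auto
  moreover have "{t \<in> {a<..b}. left_lim x t \<noteq> x t} \<subseteq> (\<Union>i. {t \<in> {a<..b}. left_lim (\<lambda>s. x s $ i) t \<noteq> x t $ i})"
    using left_lim_eq[OF nth] by (auto simp: vec_eq_iff)
  ultimately have "countable {t \<in> {a<..b}. left_lim x t \<noteq> x t}" by (rule countable_subset[rotated])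
  then show ?thesis
    unfolding set_lebesgue_integral_def
    by (rule integral_discrete_difference) (use S in \<open>auto simp: indicator_def\<close>)
qed

lemma set_integrable_mult_cadlag:
  fixes x :: "real \<Rightarrow> real^'n" and f :: "real \<Rightarrow> real"
  assumes right: "\<And>t. t \<in> {a..<b} \<Longrightarrow> continuous (at_right t) x"
    and left: "\<And>t. t \<in> {a<..b} \<Longrightarrow> \<exists>l. (x \<longlongrightarrow> l) (at_left t)"
    and f: "set_integrable lborel {a<..b} f"
  shows "set_integrable lborel {a<..b} (\<lambda>u. f u * x u $ j)"
proof -
  have r: "((\<lambda>u. x u $ j) \<longlongrightarrow> x t $ j) (at_right t)" if "t \<in> {a..<b}" for t
    using right[OF that] by (auto simp: continuous_within intro: tendsto_vec_nth)
  have l: "\<exists>l. ((\<lambda>u. x u $ j) \<longlongrightarrow> l) (at_left t)" if "t \<in> {a<..b}" for t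
    using left[OF that] tendsto_vec_nth by metis
  have "set_borel_measurable borel {a<..b} (\<lambda>u. x u $ j)"
    using r l by (intro set_borel_measurable_cadlag) (auto simp: continuous_within)
  moreover obtain B where "\<And>t. t \<in> {a..b} \<Longrightarrow> \<bar>x t $ j\<bar> \<le> B"
    using bounded_of_one_sided_limits[of a b "\<lambda>u. x u $ j"] r l by metis
  ultimately show ?thesis
    by (intro set_integrable_mult_bounded[OF f, where B = B]) auto
qed

lemma set_integrable_matrix_mult_cadlag:
  fixes x :: "real \<Rightarrow> real^'n" and M :: "real \<Rightarrow> real^'n^'m"
  assumes "\<And>t. t \<in> {a..<b} \<Longrightarrow> continuous (at_right t) x"
    and "\<And>t. t \<in> {a<..b} \<Longrightarrow> \<exists>l. (x \<longlongrightarrow> l) (at_left t)"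
    and "\<And>i j. set_integrable lborel {a<..b} (\<lambda>u. M u $ i $ j)"
  shows "set_integrable lborel {a<..b} (\<lambda>u. (M u *v x u) $ i)"
proof -
  have "set_integrable lborel {a<..b} (\<lambda>u. M u $ i $ j * x u $ j)" for j
    using assms by (rule set_integrable_mult_cadlag)
  then have "integrable lborel (\<lambda>u. \<Sum>j\<in>UNIV. indicator {a<..b} u *\<^sub>R (M u $ i $ j * x u $ j))"
    by (intro Bochner_Integration.integrable_sum) (simp add: set_integrable_def)
  then show ?thesis
    by (simp add: set_integrable_def matrix_vector_mult_def sum_distrib_left)
qed

section \<open>The transformed filter and smoother\<close>

text \<open>The statement concerns one fixed path: \<open>y\<close> is a path of the counting
  process, \<open>lam i t\<close> the intensity in state \<open>e_i\<close> along it, and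
  \<open>q\<close>, \<open>v\<close> enter as cadlag solutions of their equations.\<close>

theorem mainTheorem4:
  fixes A :: "real \<Rightarrow> real^'n^'n"
    and lam :: "'n \<Rightarrow> real \<Rightarrow> real"
    and y :: "real \<Rightarrow> nat"
    and q v :: "real \<Rightarrow> real^'n"
    and T :: real
  assumes T: "0 \<le> T"
    and A_rate_offdiag: "\<forall>t i j. i \<noteq> j \<longrightarrow> A t $ i $ j \<ge> 0"
    and A_rate_cols: "\<forall>t j. (\<Sum>i\<in>UNIV. A t $ i $ j) = 0"
    and A_int: "\<forall>i j. set_integrable lborel {0..T} (\<lambda>s. A s $ i $ j)"
    and Y: "counting_path y"
    and lam_pos: "\<forall>i. \<forall>t\<ge>0. lam i t > 0"
    and lam_lc: "\<forall>i. \<forall>t>0. continuous (at_left t) (lam i)"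
    and lam_int: "\<forall>i. set_integrable lborel {0..T} (lam i)"
    and q_rc: "\<forall>t\<in>{0..<T}. continuous (at_right t) q"
    and q_ll: "\<forall>t\<in>{0<..T}. \<exists>l. (q \<longlongrightarrow> l) (at_left t)"
    and v_rc: "\<forall>t\<in>{0..<T}. continuous (at_right t) v"
    and v_ll: "\<forall>t\<in>{0<..T}. \<exists>l. (v \<longlongrightarrow> l) (at_left t)"
    and filter_eq: "\<forall>t\<in>{0..T}. q t = q 0
        + (\<Sum>u\<in>jump_times y 0 t. dY y u *\<^sub>R ((Lam lam u - mat 1) *v left_lim q u))
        - set_lebesgue_integral lborel {0<..t} (\<lambda>u. (Lam lam u - mat 1) *v left_lim q u)
        + set_lebesgue_integral lborel {0<..t} (\<lambda>u. A u *v q u)"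
    and smoother_T: "v T = vec 1"
    and smoother_eq: "\<forall>t\<in>{0..T}. v t = vec 1
        + set_lebesgue_integral lborel {t<..T}
            (\<lambda>s. (transpose (A s) - Lam lam s + mat 1) *v left_lim v s)
        - (\<Sum>s\<in>jump_times y t T. dY y s *\<^sub>R ((matrix_inv (Lam lam s) - mat 1) *v left_lim v s))"
  shows "\<forall>t\<in>{0..T}.
      let qb = (\<lambda>s. matrix_inv (Gamma lam y s) *v q s);
          vb = (\<lambda>s. Gamma lam y s *v v s) in
      qb t = qb 0 + set_lebesgue_integral lborel {0<..t}
                 (\<lambda>s. (matrix_inv (Gamma lam y s) ** A s ** Gamma lam y s) *v qb s)
    \<and> vb t = vb 0 - set_lebesgue_integral lborel {0<..t}
                 (\<lambda>s. (Gamma lam y s ** transpose (A s) ** matrix_inv (Gamma lam y s)) *v vb s)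
    \<and> vb t = Gamma lam y T *v vec 1 + set_lebesgue_integral lborel {t<..T}
                 (\<lambda>s. (Gamma lam y s ** transpose (A s) ** matrix_inv (Gamma lam y s)) *v vb s)
    \<and> q t \<bullet> v t = qb t \<bullet> vb t"
proof -
  define J where "J = jump_times y 0 T"
  have J: "finite J" "J \<subseteq> {0<..T}"
    using finite_jump_times[OF Y] by (auto simp: J_def jump_times_def)
  have J_le: "jump_times y 0 t = {u\<in>J. u \<le> t}" if "t \<le> T" for t
    using that by (auto simp: J_def jump_times_def)
  have J_gt: "jump_times y t T = {u\<in>J. t < u}" if "0 \<le> t" for t
    using that by (auto simp: J_def jump_times_def)
  have dY1: "dY y u = 1" if "u \<in> J" for u
    using dY_jump_times[OF Y, of 0 u T] that by (simp add: J_def)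
  have lamJ: "lam i u > 0" if "u \<in> J" for i u
    using lam_pos J that by force
  have sub0: "set_integrable lborel {0<..T} f" if "set_integrable lborel {0..T} f" for f :: "real \<Rightarrow> real"
    by (rule set_integrable_subset[OF that]) auto
  have one: "set_integrable lborel {0<..T} (\<lambda>_. 1 :: real)"
    using T by (simp add: set_integrable_def)
  have lam1: "set_integrable lborel {0<..T} (\<lambda>u. lam i u - 1)" for i
    using sub0[OF lam_int[rule_format]] one by (rule set_integral_diff(1))
  have A1: "set_integrable lborel {0<..T} (\<lambda>u. A u $ i $ j)" for i j
    using A_int sub0 by blast
  have sub: "set_integrable lborel {s<..t} f"
    if "set_integrable lborel {0<..T} f" "0 \<le> s" "t \<le> T" for f :: "real \<Rightarrow> real" and s t
    by (rule set_integrable_subset[OF that(1)]) (use that in auto)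
  note q_cl = q_rc[rule_format] q_ll[rule_format]
  note v_cl = v_rc[rule_format] v_ll[rule_format]
  have q_lim: "((\<lambda>s. q s $ i) \<longlongrightarrow> left_lim q t $ i) (at_left t)" if "t \<in> {0<..T}" for t i
    using q_ll[rule_format, OF that] left_lim_eq tendsto_vec_nth by metis
  have v_lim: "((\<lambda>s. v s $ i) \<longlongrightarrow> left_lim v t $ i) (at_left t)" if "t \<in> {0<..T}" for t i
    using v_ll[rule_format, OF that] left_lim_eq tendsto_vec_nth by metis

  \<comment> \<open>\<open>G t i\<close> is the diagonal entry of \<open>Gamma\<close>. The
    exponents \<open>dY y u\<close> are dropped since they equal 1 at jump times, and indexing by
    \<open>J\<close> ties the identification to \<open>t \<le> T\<close>.\<close>
  define G where "G t i = exp (- set_lebesgue_integral lborel {0<..t} (\<lambda>s. lam i s - 1))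
      * (\<Prod>u\<in>{u\<in>J. u \<le> t}. lam i u)" for t i
  have G_pos: "G t i > 0" for t i
    unfolding G_def using lamJ by (intro mult_pos_pos prod_pos) auto
  have Gamma: "Gamma lam y t = diagm (\<chi> i. G t i)" if "t \<le> T" for t
  proof -
    have "(\<Prod>u\<in>{u\<in>J. u \<le> t}. lam i u powr dY y u) = (\<Prod>u\<in>{u\<in>J. u \<le> t}. lam i u)" for i
      using dY1 lamJ by (intro prod.cong) (auto simp: less_imp_le)
    then show ?thesis by (simp add: Gamma_def G_def J_le[OF that])
  qed
  have Gamma_inv: "matrix_inv (Gamma lam y t) = diagm (\<chi> i. inverse (G t i))" if "t \<le> T" for t
    unfolding Gamma[OF that] using G_pos by (subst matrix_inv_diagm) (auto simp: less_imp_neq[symmetric])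
  have cancel: "Gamma lam y t ** matrix_inv (Gamma lam y t) = mat 1" "matrix_inv (Gamma lam y t) ** Gamma lam y t = mat 1" if "t \<le> T" for t
    using G_pos[of t] unfolding Gamma_inv[OF that] unfolding Gamma[OF that] diagm_mult
    by (simp_all add: less_imp_neq[symmetric] flip: diagm_1)
  have Lam_mult: "((Lam lam u - mat 1) *v w) $ i = (lam i u - 1) * w $ i" for u w i
    by (simp add: Lam_def matrix_vector_mult_diff_rdistrib diagm_mult_vector left_diff_distrib)
  have Lam_inv_mult: "((matrix_inv (Lam lam u) - mat 1) *v w) $ i = (inverse (lam i u) - 1) * w $ i" if "u \<in> J" for u w i
    using lamJ[OF that]
    by (simp add: Lam_def matrix_inv_diagm less_imp_neq[symmetric] matrix_vector_mult_diff_rdistrib diagm_mult_vector left_diff_distrib)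

  \<comment> \<open>The filter, coordinate by coordinate\<close>
  have qi: "set_integrable lborel {0<..T} (\<lambda>u. inverse (G u i) * (A u *v q u) $ i)"
    and q: "t \<in> {0..T} \<Longrightarrow> inverse (G t i) * q t $ i = q 0 $ i
      + set_lebesgue_integral lborel {0<..t} (\<lambda>u. inverse (G u i) * (A u *v q u) $ i)" for i t
  proof -
    have Aq: "set_integrable lborel {0<..T} (\<lambda>u. (A u *v q u) $ i)" for i
      using q_cl A1 by (rule set_integrable_matrix_mult_cadlag)
    have hq: "set_integrable lborel {0<..T} (\<lambda>u. (lam i u - 1) * q u $ i)" for i
      using q_cl lam1 by (rule set_integrable_mult_cadlag)
    have eq: "q t $ i = q 0 $ i + (\<Sum>u\<in>{u\<in>J. u \<le> t}. (lam i u - 1) * left_lim q u $ i)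
        - set_lebesgue_integral lborel {0<..t} (\<lambda>u. (lam i u - 1) * q u $ i)
        + set_lebesgue_integral lborel {0<..t} (\<lambda>u. (A u *v q u) $ i)" if t: "t \<in> {0..T}" for t
    proof -
      have "set_lebesgue_integral lborel {0<..t} (\<lambda>u. (Lam lam u - mat 1) *v left_lim q u)
          = set_lebesgue_integral lborel {0<..t} (\<lambda>u. (Lam lam u - mat 1) *v q u)"
        using q_ll t by (intro set_integral_left_lim[of 0 T]) auto
      moreover have "set_lebesgue_integral lborel {0<..t} (\<lambda>u. (Lam lam u - mat 1) *v q u) $ i
          = set_lebesgue_integral lborel {0<..t} (\<lambda>u. (lam i u - 1) * q u $ i)"
        using sub[OF hq, of 0 t] t by (subst set_lebesgue_integral_vec_nth) (simp_all add: Lam_mult)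
      moreover have "set_lebesgue_integral lborel {0<..t} (\<lambda>u. A u *v q u) $ i
          = set_lebesgue_integral lborel {0<..t} (\<lambda>u. (A u *v q u) $ i)"
        using sub[OF Aq, of 0 t] t by (intro set_lebesgue_integral_vec_nth) simp
      moreover have "(\<Sum>u\<in>{u\<in>J. u \<le> t}. dY y u *\<^sub>R ((Lam lam u - mat 1) *v left_lim q u)) $ i
          = (\<Sum>u\<in>{u\<in>J. u \<le> t}. (lam i u - 1) * left_lim q u $ i)"
        unfolding sum_component by (rule sum.cong) (auto simp: dY1 Lam_mult)
      ultimately show ?thesis
        using filter_eq[rule_format, OF t] J_le[of t] t by (simp add: vec_eq_iff)
    qed
    \<comment> \<open>For \<open>m = lam i\<close> and \<open>h = lam i - 1\<close> the integrating
      factor is the reciprocal entry of \<open>Gamma\<close>.\<close>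
    have G: "exp (set_lebesgue_integral lborel {0<..t} (\<lambda>u. lam i u - 1)) * (\<Prod>u\<in>{u\<in>J. u \<le> t}. inverse (lam i u))
        = inverse (G t i)" for t
      using prod_inversef[of "lam i" "{u\<in>J. u \<le> t}"]
      by (simp add: G_def exp_minus comp_def)
    have lim: "((\<lambda>s. q s $ i) \<longlongrightarrow> left_lim q u $ i) (at_left u)" if "u \<in> J" for u
      using q_lim J that by blast
    note F = integrating_factor[where x = "\<lambda>t. q t $ i" and xl = "\<lambda>u. left_lim q u $ i" and m = "lam i", OF J lamJ lim lam1 Aq hq eq, unfolded G]
    show "set_integrable lborel {0<..T} (\<lambda>u. inverse (G u i) * (A u *v q u) $ i)" using F(1) .
    show "t \<in> {0..T} \<Longrightarrow> inverse (G t i) * q t $ i = q 0 $ i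
      + set_lebesgue_integral lborel {0<..t} (\<lambda>u. inverse (G u i) * (A u *v q u) $ i)" using F(2) .
  qed

  \<comment> \<open>The smoother, coordinate by coordinate\<close>
  have vi: "set_integrable lborel {0<..T} (\<lambda>u. G u i * (transpose (A u) *v v u) $ i)"
    and v: "t \<in> {0..T} \<Longrightarrow> G t i * v t $ i = v 0 $ i
      - set_lebesgue_integral lborel {0<..t} (\<lambda>u. G u i * (transpose (A u) *v v u) $ i)" for i t
  proof -
    have Av: "set_integrable lborel {0<..T} (\<lambda>u. (transpose (A u) *v v u) $ i)" for i
      using v_cl A1 by (intro set_integrable_matrix_mult_cadlag) (auto simp: transpose_def)
    have Av': "set_integrable lborel {0<..T} (\<lambda>u. - (transpose (A u) *v v u) $ i)"
      using set_integrable_mult_right[of "-1", OF Av] by simp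
    have lam1': "set_integrable lborel {0<..T} (\<lambda>u. 1 - lam i u)" for i
      using one sub0[OF lam_int[rule_format]] by (rule set_integral_diff(1))
    have hv: "set_integrable lborel {0<..T} (\<lambda>u. (1 - lam i u) * v u $ i)" for i
      using v_cl lam1' by (rule set_integrable_mult_cadlag)
    define N where "N u = transpose (A u) - Lam lam u + mat 1" for u
    have N: "(N u *v w) $ i = (transpose (A u) *v w) $ i + (1 - lam i u) * w $ i" for u w i
      by (simp add: N_def Lam_def matrix_vector_mult_diff_rdistrib matrix_vector_mult_add_rdistrib diagm_mult_vector left_diff_distrib)
    have Nv: "set_integrable lborel {0<..T} (\<lambda>u. (N u *v v u) $ i)" for i
      unfolding N using Av hv by (rule set_integral_add(1))
    have bwd: "v t $ i = 1 + set_lebesgue_integral lborel {t<..T} (\<lambda>u. (N u *v v u) $ i)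
        - (\<Sum>u\<in>{u\<in>J. t < u}. (inverse (lam i u) - 1) * left_lim v u $ i)" if t: "t \<in> {0..T}" for t
    proof -
      have "set_lebesgue_integral lborel {t<..T} (\<lambda>u. N u *v left_lim v u)
          = set_lebesgue_integral lborel {t<..T} (\<lambda>u. N u *v v u)"
        using v_ll t by (intro set_integral_left_lim[of 0 T]) auto
      moreover have "set_lebesgue_integral lborel {t<..T} (\<lambda>u. N u *v v u) $ i
          = set_lebesgue_integral lborel {t<..T} (\<lambda>u. (N u *v v u) $ i)"
        using sub[OF Nv, of t T] t by (intro set_lebesgue_integral_vec_nth) simp
      moreover have "(\<Sum>u\<in>{u\<in>J. t < u}. dY y u *\<^sub>R ((matrix_inv (Lam lam u) - mat 1) *v left_lim v u)) $ i
          = (\<Sum>u\<in>{u\<in>J. t < u}. (inverse (lam i u) - 1) * left_lim v u $ i)"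
        unfolding sum_component by (rule sum.cong) (auto simp: dY1 Lam_inv_mult)
      ultimately show ?thesis
        using smoother_eq[rule_format, OF t] J_gt[of t] t by (simp add: N_def vec_eq_iff)
    qed
    \<comment> \<open>The smoother equation runs backward from \<open>T\<close>; subtracting its
      instances at \<open>t\<close> and at 0 produces the forward form required by
      \<open>integrating_factor\<close>.\<close>
    have eq: "v t $ i = v 0 $ i + (\<Sum>u\<in>{u\<in>J. u \<le> t}. (inverse (lam i u) - 1) * left_lim v u $ i)
        - set_lebesgue_integral lborel {0<..t} (\<lambda>u. (1 - lam i u) * v u $ i)
        + set_lebesgue_integral lborel {0<..t} (\<lambda>u. - (transpose (A u) *v v u) $ i)" if t: "t \<in> {0..T}" for t
    proof -
      have "{u\<in>J. 0 < u} = {u\<in>J. u \<le> t} \<union> {u\<in>J. t < u}" using J by auto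
      then have "(\<Sum>u\<in>{u\<in>J. 0 < u}. (inverse (lam i u) - 1) * left_lim v u $ i)
          = (\<Sum>u\<in>{u\<in>J. u \<le> t}. (inverse (lam i u) - 1) * left_lim v u $ i)
          + (\<Sum>u\<in>{u\<in>J. t < u}. (inverse (lam i u) - 1) * left_lim v u $ i)"
        using J by (simp only:) (rule sum.union_disjoint; auto)
      moreover have "set_lebesgue_integral lborel {0<..T} (\<lambda>u. (N u *v v u) $ i) - set_lebesgue_integral lborel {0<..t} (\<lambda>u. (N u *v v u) $ i)
          = set_lebesgue_integral lborel {t<..T} (\<lambda>u. (N u *v v u) $ i)"
        using t by (intro indefinite_integral_diff[OF Nv]) auto
      moreover have "set_lebesgue_integral lborel {0<..t} (\<lambda>u. (N u *v v u) $ i)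
          = set_lebesgue_integral lborel {0<..t} (\<lambda>u. (transpose (A u) *v v u) $ i)
          + set_lebesgue_integral lborel {0<..t} (\<lambda>u. (1 - lam i u) * v u $ i)"
        unfolding N using t by (intro set_integral_add(2) sub[OF Av] sub[OF hv]) auto
      moreover have "set_lebesgue_integral lborel {0<..t} (\<lambda>u. - (transpose (A u) *v v u) $ i)
          = - set_lebesgue_integral lborel {0<..t} (\<lambda>u. (transpose (A u) *v v u) $ i)"
        using t by (intro set_integral_uminus sub[OF Av]) auto
      ultimately show ?thesis
        using bwd[of t] bwd[of 0] t by simp
    qed
    \<comment> \<open>Here the integrating factor is \<open>G\<close> itself. The identity is
      derived for \<open>t \<le> T\<close>, since pulling out the sign uses integrability, so under
      the integrals it is applied by congruence on the domain of integration.\<close>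
    have G: "exp (set_lebesgue_integral lborel {0<..t} (\<lambda>u. 1 - lam i u)) * (\<Prod>u\<in>{u\<in>J. u \<le> t}. inverse (inverse (lam i u)))
        = G t i" if "t \<le> T" for t
    proof -
      have "set_lebesgue_integral lborel {0<..t} (\<lambda>u. - (lam i u - 1)) = - set_lebesgue_integral lborel {0<..t} (\<lambda>u. lam i u - 1)"
        using that by (intro set_integral_uminus sub[OF lam1]) auto
      then show ?thesis by (simp add: G_def)
    qed
    have lim: "((\<lambda>s. v s $ i) \<longlongrightarrow> left_lim v u $ i) (at_left u)" if "u \<in> J" for u
      using v_lim J that by blast
    have pos: "inverse (lam i u) > 0" if "u \<in> J" for u using lamJ[OF that] by simp
    note F = integrating_factor[where x = "\<lambda>t. v t $ i" and xl = "\<lambda>u. left_lim v u $ i" and m = "\<lambda>u. inverse (lam i u)", OF J pos lim lam1' Av' hv eq]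
    have "set_integrable lborel {0<..T} (\<lambda>u. G u i * - (transpose (A u) *v v u) $ i)"
      using F(1) by (rule set_integrable_cong[THEN iffD1, rotated 3]) (simp_all add: G[simplified])
    from set_integrable_mult_right[of "-1", OF this]
    show int: "set_integrable lborel {0<..T} (\<lambda>u. G u i * (transpose (A u) *v v u) $ i)" by simp
    show "G t i * v t $ i = v 0 $ i
      - set_lebesgue_integral lborel {0<..t} (\<lambda>u. G u i * (transpose (A u) *v v u) $ i)" if t: "t \<in> {0..T}"
    proof -
      have "G t i * v t $ i = v 0 $ i + set_lebesgue_integral lborel {0<..t} (\<lambda>u. G u i * - (transpose (A u) *v v u) $ i)"
      proof -
        have "set_lebesgue_integral lborel {0<..t} (\<lambda>u. exp (set_lebesgue_integral lborel {0<..u} (\<lambda>u. 1 - lam i u)) * (\<Prod>u\<in>{w\<in>J. w \<le> u}. inverse (inverse (lam i u))) * - (transpose (A u) *v v u) $ i)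
           = set_lebesgue_integral lborel {0<..t} (\<lambda>u. G u i * - (transpose (A u) *v v u) $ i)"
          using t by (intro set_lebesgue_integral_cong) (simp_all add: G[simplified])
        then show ?thesis using F(2)[OF _ _ _ t] G[of t] t by simp
      qed
      also have "set_lebesgue_integral lborel {0<..t} (\<lambda>u. G u i * - (transpose (A u) *v v u) $ i)
          = - set_lebesgue_integral lborel {0<..t} (\<lambda>u. G u i * (transpose (A u) *v v u) $ i)"
        using set_integral_uminus[OF sub[OF int, of 0 t]] t by simp
      finally show ?thesis by simp
    qed
  qed

  \<comment> \<open>Assembling the vector equations\<close>
  have G0: "G 0 i = 1" for i
  proof -
    have "{u\<in>J. u \<le> 0} = {}" using J by auto
    then show ?thesis unfolding G_def by (simp only: prod.empty) (simp add: set_lebesgue_integral_def)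
  qed
  show ?thesis
  proof (intro ballI)
    fix t assume t: "t \<in> {0..T}"
    define qb where "qb = (\<lambda>s. matrix_inv (Gamma lam y s) *v q s)"
    define vb where "vb = (\<lambda>s. Gamma lam y s *v v s)"
    have qb: "qb s $ i = inverse (G s i) * q s $ i" if "s \<le> T" for s i
      by (simp add: qb_def Gamma_inv[OF that] diagm_mult_vector)
    have vb: "vb s $ i = G s i * v s $ i" if "s \<le> T" for s i
      by (simp add: vb_def Gamma[OF that] diagm_mult_vector)
    define fq where "fq = (\<lambda>s. (matrix_inv (Gamma lam y s) ** A s ** Gamma lam y s) *v qb s)"
    define fv where "fv = (\<lambda>s. (Gamma lam y s ** transpose (A s) ** matrix_inv (Gamma lam y s)) *v vb s)"
    \<comment> \<open>The inner factor \<open>Gamma\<close> meets the inverse contained in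
      \<open>qb\<close> and cancels, which leaves the integrand of the scalar equation;
      \<open>fv\<close> works the same way.\<close>
    have fq: "fq s $ i = inverse (G s i) * (A s *v q s) $ i" if "s \<le> T" for s i
    proof -
      have "fq s = matrix_inv (Gamma lam y s) *v (A s *v ((Gamma lam y s ** matrix_inv (Gamma lam y s)) *v q s))"
        by (simp add: fq_def qb_def matrix_vector_mul_assoc matrix_mul_assoc)
      then show ?thesis by (simp add: cancel[OF that]) (simp add: Gamma_inv[OF that] diagm_mult_vector)
    qed
    have fv: "fv s $ i = G s i * (transpose (A s) *v v s) $ i" if "s \<le> T" for s i
    proof -
      have "fv s = Gamma lam y s *v (transpose (A s) *v ((matrix_inv (Gamma lam y s) ** Gamma lam y s) *v v s))"
        by (simp add: fv_def vb_def matrix_vector_mul_assoc matrix_mul_assoc)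
      then show ?thesis by (simp only: cancel[OF that] matrix_vector_mul_lid) (simp add: Gamma[OF that] diagm_mult_vector)
    qed
    have fq_int: "set_lebesgue_integral lborel {r<..s} fq $ i
        = set_lebesgue_integral lborel {r<..s} (\<lambda>u. inverse (G u i) * (A u *v q u) $ i)" if "0 \<le> r" "s \<le> T" for r s i
    proof -
      have "set_lebesgue_integral lborel {r<..s} fq = set_lebesgue_integral lborel {r<..s} (\<lambda>u. \<chi> i. inverse (G u i) * (A u *v q u) $ i)"
        using that fq by (intro set_lebesgue_integral_cong) (auto simp: vec_eq_iff)
      then show ?thesis
        using sub[OF qi that] by (simp add: set_lebesgue_integral_vec_nth)
    qed
    have fv_int: "set_lebesgue_integral lborel {r<..s} fv $ i
        = set_lebesgue_integral lborel {r<..s} (\<lambda>u. G u i * (transpose (A u) *v v u) $ i)" if "0 \<le> r" "s \<le> T" for r s i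
    proof -
      have "set_lebesgue_integral lborel {r<..s} fv = set_lebesgue_integral lborel {r<..s} (\<lambda>u. \<chi> i. G u i * (transpose (A u) *v v u) $ i)"
        using that fv by (intro set_lebesgue_integral_cong) (auto simp: vec_eq_iff)
      then show ?thesis
        using sub[OF vi that] by (simp add: set_lebesgue_integral_vec_nth)
    qed
    have "qb t = qb 0 + set_lebesgue_integral lborel {0<..t} fq"
      using t T q by (simp add: vec_eq_iff qb fq_int G0)
    moreover have vb_fwd: "vb s = vb 0 - set_lebesgue_integral lborel {0<..s} fv" if "s \<in> {0..T}" for s
      using that T v by (simp add: vec_eq_iff vb fv_int G0)
    \<comment> \<open>The terminal form is the difference of the forward equation at
      \<open>T\<close> and at \<open>t\<close>, combined with \<open>v T = vec 1\<close>.\<close>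
    moreover have "vb t = Gamma lam y T *v vec 1 + set_lebesgue_integral lborel {t<..T} fv"
    proof -
      have "set_lebesgue_integral lborel {0<..T} fv - set_lebesgue_integral lborel {0<..t} fv = set_lebesgue_integral lborel {t<..T} fv"
        using indefinite_integral_diff[OF vi, of t T] t by (simp add: vec_eq_iff fv_int)
      moreover have "vb T = Gamma lam y T *v vec 1" by (simp add: vb_def smoother_T)
      ultimately show ?thesis
        using vb_fwd[OF t] vb_fwd[of T] T by (simp add: algebra_simps)
    qed
    moreover have "q t \<bullet> v t = qb t \<bullet> vb t"
    proof -
      have "G t i \<noteq> 0" for i using G_pos[of t i] by simp
      then show ?thesis using t by (simp add: inner_vec_def qb vb field_simps)
    qed
    ultimately show "let qb = (\<lambda>s. matrix_inv (Gamma lam y s) *v q s);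
          vb = (\<lambda>s. Gamma lam y s *v v s) in
      qb t = qb 0 + set_lebesgue_integral lborel {0<..t}
                 (\<lambda>s. (matrix_inv (Gamma lam y s) ** A s ** Gamma lam y s) *v qb s)
    \<and> vb t = vb 0 - set_lebesgue_integral lborel {0<..t}
                 (\<lambda>s. (Gamma lam y s ** transpose (A s) ** matrix_inv (Gamma lam y s)) *v vb s)
    \<and> vb t = Gamma lam y T *v vec 1 + set_lebesgue_integral lborel {t<..T}
                 (\<lambda>s. (Gamma lam y s ** transpose (A s) ** matrix_inv (Gamma lam y s)) *v vb s)
    \<and> q t \<bullet> v t = qb t \<bullet> vb t"
      using t unfolding Let_def fq_def fv_def unfolding qb_def vb_def by blast
  qed
qed

end
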